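(* Let $F_{[X]}\colon\mathbb{R}^2\to[0,1]$ be a containment distribution function, i.e. a function with the properties (i)–(iv) listed in the context. Then $F_{[X]}$ determines a unique distribution of $[X]$ (a probability measure on $(\mathbb{I},\mathscr{B}_{\mathbb{I}})$), such that $$P([X]\subseteq[x])=F_{[X]}(\underline{x},\overline{x})\quad\text{for all }[x]=[\underline{x},\overline{x}]\in\mathbb{I}.$$
   Context: $\mathbb{I}=\{[x,y]\colon -\infty<x\le y<+\infty\}$ is the set of closed bounded intervals of $\mathbb{R}$; for $[x]\in\mathbb{I}$ write $[x]=[\underline{x},\overline{x}]$. $\mathbb{I}$ carries the Hausdorff metric $d_H([a],[b])=\max\{|\underline{a}-\underline{b}|,|\overline{a}-\overline{b}|\}$, and $\mathscr{B}_{\mathbb{I}}$ is its Borel $\sigma$-algebra. A random interval $[X]=[\underline{X},\overline{X}]$ is a random element of $\mathbb{I}$. The containment distribution function $F_{[X]}\colon\mathbb{R}^2\to[0,1]$ of the random interval $[X]$ is defined by the following properties: (i) $F_{[X]}(-\infty,+\infty)=1$ (that is, $F_{[X]}(\underline{x},\overline{x})\to1$ when $\underline{x}\to-\infty$ and $\overline{x}\to+\infty$), and $F_{[X]}(\underline{x},\overline{x})=0$ when $\underline{x}>\overline{x}$; (ii) $F_{[X]}(\underline{x},\overline{x})$ is left-continuous in $\underline{x}$ and right-continuous in $\overline{x}$; (iii) $F_{[X]}(\underline{x},\overline{x})$ is non-increasing in $\underline{x}$ and non-decreasing in $\overline{x}$; (iv) for $\underline{y}\le\underline{x}\le\overline{x}\le\overline{y}$,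 $F_{[X]}(\underline{y},\overline{y})-F_{[X]}(\underline{y},\overline{x})-F_{[X]}(\underline{x},\overline{y})+F_{[X]}(\underline{x},\overline{x})\ge0$.
   Formalization: Inequality (iv) is assumed also when the lower y ≤ upper x < lower x ≤ upper y (disjoint subintervals); without it the claim fails for F=1 if lower x ≤ upper x, else 0; every F for which the claimed distribution exists satisfies it. *)

theory Defs
  imports "HOL-Probability.Probability" "HOL-Library.Interval"
begin

definition hausdorff_ivl :: "real interval \<Rightarrow> real interval \<Rightarrow> real" where
  "hausdorff_ivl a b = max \<bar>lower a - lower b\<bar> \<bar>upper a - upper b\<bar>"

interpretation ivl: Metric_space UNIV hausdorff_ivl
  by standard (auto simp: hausdorff_ivl_def interval_eq_iff)

text \<open>
  The Borel sets are generated by the open sets of the Hausdorff metric. The class instance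
  \<^class>\<open>topological_space\<close> of \<^type>\<open>interval\<close> (and hence \<^const>\<open>borel\<close>) is not usable here:
  its open sets are defined by images under \<^const>\<open>Interval\<close> of boxes that also contain pairs
  \<open>(a, b)\<close> with \<open>b < a\<close>, where \<^const>\<open>Interval\<close> is unspecified.
\<close>

definition borel_ivl :: "real interval measure" where
  "borel_ivl = sigma UNIV {U. openin ivl.mtopology U}"

definition containment_df :: "(real \<Rightarrow> real \<Rightarrow> real) \<Rightarrow> bool" where
  "containment_df F \<longleftrightarrow>
     (\<forall>x y. 0 \<le> F x y \<and> F x y \<le> 1) \<and>
     ((\<lambda>(x, y). F x y) \<longlongrightarrow> 1) (at_bot \<times>\<^sub>F at_top) \<and>
     (\<forall>x y. y < x \<longrightarrow> F x y = 0) \<and>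
     (\<forall>x y. continuous (at_left x) (\<lambda>x'. F x' y)) \<and>
     (\<forall>x y. continuous (at_right y) (\<lambda>y'. F x y')) \<and>
     (\<forall>y. antimono (\<lambda>x. F x y)) \<and>
     (\<forall>x. mono (\<lambda>y. F x y)) \<and>
     (\<forall>yl xl xu yu. yl \<le> xl \<and> xl \<le> xu \<and> xu \<le> yu \<longrightarrow>
        F yl yu - F yl xu - F xl yu + F xl xu \<ge> 0)"

definition has_containment_df :: "real interval measure \<Rightarrow> (real \<Rightarrow> real \<Rightarrow> real) \<Rightarrow> bool" where
  "has_containment_df M F \<longleftrightarrow>
     (\<forall>x. measure M {X. set_of X \<subseteq> set_of x} = F (lower x) (upper x))"

text \<open>
  The last condition of \<^const>\<open>containment_df\<close> is only required for \<open>xl \<le> xu\<close>, and then the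
  conditions do not characterise containment functions of probability measures: the indicator
  function of \<open>x \<le> y\<close> satisfies them all, but would put mass 1 on every singleton interval
  (\<open>containment_df_not_sufficient\<close>). The same inequality for \<open>xu < xl\<close>, which with \<open>F xl xu = 0\<close>
  is superadditivity over disjoint subintervals, is necessary
  (\<open>has_containment_df_rectangle_disjoint\<close>) and has to be assumed for existence.
\<close>

lemma containment_df_indicator: "containment_df (\<lambda>x y. of_bool (x \<le> y))"
proof -
  have ev: "\<forall>\<^sub>F p in at_bot \<times>\<^sub>F at_top. (1::real) = (case p of (x::real, y::real) \<Rightarrow> of_bool (x \<le> y))"
    using eventually_prodI[OF eventually_le_at_bot[of "0::real"] eventually_ge_at_top[of "0::real"]]
    by eventually_elim auto
  have lim: "((\<lambda>(x::real, y::real). of_bool (x \<le> y)) \<longlongrightarrow> (1::real)) (at_bot \<times>\<^sub>F at_top)"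
    using tendsto_cong[THEN iffD1, OF ev tendsto_const] .
  have left: "continuous (at_left x) (\<lambda>x'. of_bool (x' \<le> y) :: real)" for x y :: real
  proof (cases "x \<le> y")
    case True
    then have "\<forall>\<^sub>F x' in at_left x. (1::real) = of_bool (x' \<le> y)"
      by (auto simp: eventually_at_filter)
    from tendsto_cong[THEN iffD1, OF this tendsto_const] show ?thesis
      using True by (simp add: continuous_within)
  next
    case False
    then have "\<forall>\<^sub>F x' in at_left x. (0::real) = of_bool (x' \<le> y)"
      by (intro eventually_mono[OF eventually_at_left_real[of y x]]) auto
    from tendsto_cong[THEN iffD1, OF this tendsto_const] show ?thesis
      using False by (simp add: continuous_within)
  qed
  have right: "continuous (at_right y) (\<lambda>y'. of_bool (x \<le> y') :: real)" for x y :: real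
  proof (cases "x \<le> y")
    case True
    then have "\<forall>\<^sub>F y' in at_right y. (1::real) = of_bool (x \<le> y')"
      by (auto simp: eventually_at_filter)
    from tendsto_cong[THEN iffD1, OF this tendsto_const] show ?thesis
      using True by (simp add: continuous_within)
  next
    case False
    then have "\<forall>\<^sub>F y' in at_right y. (0::real) = of_bool (x \<le> y')"
      by (intro eventually_mono[OF eventually_at_right_real[of y x]]) auto
    from tendsto_cong[THEN iffD1, OF this tendsto_const] show ?thesis
      using False by (simp add: continuous_within)
  qed
  show ?thesis
    unfolding containment_df_def using lim left right
    by (simp add: monotone_def)
qed

lemma containment_df_not_sufficient:
  "\<exists>F. containment_df F \<and>
     \<not> (\<exists>M. prob_space M \<and> sets M = sets borel_ivl \<and> has_containment_df M F)"
proof (intro exI conjI notI)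
  show "containment_df (\<lambda>x y. of_bool (x \<le> y))"
    by (rule containment_df_indicator)
  assume "\<exists>M. prob_space M \<and> sets M = sets borel_ivl \<and> has_containment_df M (\<lambda>x y. of_bool (x \<le> y))"
  then obtain M where "prob_space M" and M: "has_containment_df M (\<lambda>x y. of_bool (x \<le> y))"
    by blast
  interpret prob_space M by fact
  define A where "A c = {X. set_of X \<subseteq> set_of (interval_of c)}" for c :: real
  have one: "measure M (A c) = 1" for c
    using M by (simp add: has_containment_df_def A_def)
  then have "A c \<in> sets M" for c
    by (metis measure_notin_sets zero_neq_one)
  moreover have "A 0 \<inter> A 1 = {}"
  proof (rule ccontr)
    assume "A 0 \<inter> A 1 \<noteq> {}"
    then obtain X where "X \<in> A 0" "X \<in> A 1"
      by blast
    then have "set_of X \<subseteq> {0}" "set_of X \<subseteq> {1}"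
      by (simp_all add: A_def set_of_eq[of "interval_of _"])
    moreover have "lower X \<in> set_of X"
      by (simp add: set_of_eq)
    ultimately have "lower X = 0" "lower X = 1"
      by auto
    then show False
      by simp
  qed
  ultimately have "measure M (A 0 \<union> A 1) = 2"
    by (simp add: finite_measure_Union one)
  then show False
    using prob_le_1[of "A 0 \<union> A 1"] by simp
qed

lemma openin_ivl_lower_less: "openin ivl.mtopology {X. lower X < a}" (is ?L)
  and openin_ivl_upper_greater: "openin ivl.mtopology {X. b < upper X}" (is ?U)
proof -
  show ?L
    unfolding ivl.openin_mtopology
  proof (intro conjI allI impI)
    fix X assume "X \<in> {X. lower X < a}"
    then show "\<exists>r>0. ivl.mball X r \<subseteq> {X. lower X < a}"
      by (intro exI[of _ "a - lower X"]) (auto simp: ivl.mball_def hausdorff_ivl_def)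
  qed auto
  show ?U
    unfolding ivl.openin_mtopology
  proof (intro conjI allI impI)
    fix X assume "X \<in> {X. b < upper X}"
    then show "\<exists>r>0. ivl.mball X r \<subseteq> {X. b < upper X}"
      by (intro exI[of _ "upper X - b"]) (auto simp: ivl.mball_def hausdorff_ivl_def)
  qed auto
qed

lemma sets_borel_ivl_containment: "{X. set_of X \<subseteq> set_of x} \<in> sets borel_ivl"
proof -
  have sp: "space borel_ivl = UNIV"
    by (simp add: borel_ivl_def)
  have U: "U \<in> sets borel_ivl" if "openin ivl.mtopology U" for U
    using that by (simp add: borel_ivl_def)
  have "{X. set_of X \<subseteq> set_of x} = space borel_ivl - ({X. lower X < lower x} \<union> {X. upper x < upper X})"
    by (auto simp: sp set_of_eq not_less)
  then show ?thesis
    using U[OF openin_ivl_lower_less] U[OF openin_ivl_upper_greater] by auto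
qed

lemma has_containment_df_rectangle_disjoint:
  assumes "prob_space M" and M: "sets M = sets borel_ivl" and F: "has_containment_df M F"
    and zero: "\<And>x y. y < x \<Longrightarrow> F x y = 0"
    and le: "yl \<le> xu" "xu < xl" "xl \<le> yu"
  shows "F yl yu - F yl xu - F xl yu + F xl xu \<ge> 0"
proof -
  interpret prob_space M by fact
  define A where "A x = {X. set_of X \<subseteq> set_of x}" for x :: "real interval"
  have A: "A x \<in> sets M" for x
    using sets_borel_ivl_containment M by (simp add: A_def)
  have Ivl: "\<exists>x. lower x = a \<and> upper x = b" if "a \<le> b" for a b :: real
    using that by (intro exI[of _ "Interval (a, b)"]) (simp add: lower.rep_eq upper.rep_eq Interval_inverse)
  obtain P Q R where b: "lower P = yl" "upper P = yu" "lower Q = yl" "upper Q = xu"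
      "lower R = xl" "upper R = yu"
    using Ivl[of yl yu] Ivl[of yl xu] Ivl[of xl yu] le by auto
  have disj: "A Q \<inter> A R = {}"
  proof (rule ccontr)
    assume "A Q \<inter> A R \<noteq> {}"
    then obtain X where "set_of X \<subseteq> set_of Q" "set_of X \<subseteq> set_of R"
      by (auto simp: A_def)
    moreover have "lower X \<in> set_of X"
      by (simp add: set_of_eq)
    ultimately have "lower X \<le> xu" "xl \<le> lower X"
      unfolding set_of_eq b by (meson atLeastAtMost_iff subsetD)+
    then show False
      using le by linarith
  qed
  have "A Q \<union> A R \<subseteq> A P"
  proof
    fix X assume "X \<in> A Q \<union> A R"
    moreover have "set_of Q \<subseteq> set_of P" "set_of R \<subseteq> set_of P"
      using le by (simp_all add: set_of_eq b)
    ultimately show "X \<in> A P"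
      unfolding A_def by blast
  qed
  then have "measure M (A Q \<union> A R) \<le> measure M (A P)"
    using A by (intro finite_measure_mono) auto
  then have "measure M (A Q) + measure M (A R) \<le> measure M (A P)"
    using A disj by (simp add: finite_measure_Union)
  then have "F yl xu + F xl yu \<le> F yl yu"
    using F by (simp add: has_containment_df_def A_def b)
  then show ?thesis
    using zero[OF le(2)] by simp
qed

end

theory Submission
  imports Defs
begin

text \<open>
  For fixed \<open>x\<close> the function \<open>F x\<close> is the distribution function of a measure \<open>\<nu> x\<close> on the line, to
  be thought of as \<open>B \<mapsto> P(lower X \<ge> x, upper X \<in> B)\<close>. The rectangle inequality makes \<open>\<nu> x\<close>
  decreasing in \<open>x\<close>, so that \<open>\<mu> = sup\<^sub>n \<nu> (- n)\<close> is a probability measure (the law of the upper end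
  point), and the density \<open>g x\<close> of \<open>\<nu> x\<close> with respect to \<open>\<mu>\<close> is the conditional survival function of
  the lower end point. Inverting it at an independent uniform level \<open>u\<close> yields a pair of end points
  whose law \<open>N\<close> satisfies \<open>F a b \<le> N ({a..} \<times> {..b}) \<le> F q b\<close> for all \<open>q < a\<close>; left-continuity
  of \<open>F\<close> in its first argument closes the gap. Uniqueness holds because the events
  \<open>X \<subseteq> x\<close> form a generator of the Borel sets closed under intersection.
\<close>

section \<open>Comparison of Stieltjes measures on the line\<close>

lemma mono_tendsto_0_at_bot_nonneg:
  fixes F :: "real \<Rightarrow> real"
  assumes "mono F" "(F \<longlongrightarrow> 0) at_bot"
  shows "0 \<le> F x"
  using assms(2) by (rule tendsto_upperbound)
    (use assms(1) in \<open>auto simp: eventually_at_bot_linorder mono_def intro!: exI[of _ x]\<close>)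

lemma mono_tendsto_SUP_at_top:
  fixes F :: "real \<Rightarrow> real"
  assumes "mono F" "bdd_above (range F)"
  shows "(F \<longlongrightarrow> (SUP x. F x)) at_top"
proof (rule order_tendstoI)
  fix a assume "a < (SUP x. F x)"
  then obtain x where x: "a < F x"
    using less_cSUP_iff[OF _ assms(2)] by auto
  have "a < F y" if "x \<le> y" for y
    using x monoD[OF assms(1) that] by (rule less_le_trans)
  then show "\<forall>\<^sub>F x in at_top. a < F x"
    unfolding eventually_at_top_linorder by blast
next
  fix a assume a: "(SUP x. F x) < a"
  have "F x < a" for x
    using cSUP_upper[OF UNIV_I assms(2)] a by (rule le_less_trans)
  then show "\<forall>\<^sub>F x in at_top. F x < a"
    by simp
qed

lemma finite_interval_measure:
  assumes "mono F" "\<And>a. continuous (at_right a) F" "(F \<longlongrightarrow> 0) at_bot" "bdd_above (range F)"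
  shows "finite_measure (interval_measure F)"
proof -
  have "0 \<le> (SUP x. F x)"
    using mono_tendsto_0_at_bot_nonneg[OF assms(1,3)] cSUP_upper[OF UNIV_I assms(4)] order_trans by blast
  then show ?thesis
    using finite_borel_measure_interval_measure[of F, OF _ assms(2,3) mono_tendsto_SUP_at_top[OF assms(1,4)]]
      assms(1) by (auto simp: mono_def finite_borel_measure_def)
qed

text \<open>\<open>G - F\<close> is itself a distribution function, so on half-lines the measure of
  \<open>G\<close> is the sum of the measures of \<open>F\<close> and \<open>G - F\<close>. Dynkin's
  theorem carries this additivity to all Borel sets, and dropping the nonnegative summand gives the
  inequality.\<close>

lemma interval_measure_le:
  fixes F G :: "real \<Rightarrow> real"
  assumes F: "mono F" "\<And>a. continuous (at_right a) F" "(F \<longlongrightarrow> 0) at_bot"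
    and G: "mono G" "\<And>a. continuous (at_right a) G" "(G \<longlongrightarrow> 0) at_bot"
    and bounded: "bdd_above (range G)" and diff: "mono (\<lambda>x. G x - F x)"
  shows "interval_measure F \<le> interval_measure G"
proof -
  let ?D = "\<lambda>x. G x - F x"
  have D: "mono ?D" "\<And>a. continuous (at_right a) ?D" "(?D \<longlongrightarrow> 0) at_bot"
    using diff F(2) G(2) tendsto_diff[OF G(3) F(3)] by (auto intro: continuous_diff)
  obtain K where K: "G x \<le> K" for x
    using bounded by (auto simp: bdd_above_def)
  \<comment> \<open>\<open>F\<close> and \<open>?D\<close> are nonnegative, being monotone with
    limit 0 at minus infinity, and they sum to \<open>G\<close>; so a bound for \<open>G\<close>
    bounds each.\<close>
  have "F x \<le> K" "?D x \<le> K" for x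
    using mono_tendsto_0_at_bot_nonneg[OF F(1,3), of x] mono_tendsto_0_at_bot_nonneg[OF D(1,3), of x] K[of x]
    by linarith+
  then have bF: "bdd_above (range F)" and bD: "bdd_above (range ?D)"
    unfolding bdd_above_def by blast+
  interpret MF: finite_measure "interval_measure F" by (rule finite_interval_measure[OF F bF])
  interpret MG: finite_measure "interval_measure G" by (rule finite_interval_measure[OF G bounded])
  interpret MD: finite_measure "interval_measure ?D" by (rule finite_interval_measure[OF D bD])
  let ?P = "\<lambda>A. measure (interval_measure G) A = measure (interval_measure F) A + measure (interval_measure ?D) A"
  have Iic: "?P {..x}" for x
    using F G D by (simp add: measure_interval_measure_Iic mono_def)
  have UN: "(\<Union>n. {..real n}) = UNIV"
    using real_arch_simple by auto
  have lim: "(\<lambda>n. measure M {..real n}) \<longlonglongrightarrow> measure M UNIV" if "finite_measure M" "sets M = sets borel" for M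
  proof -
    have "range (\<lambda>n. {..real n}) \<subseteq> sets M" "incseq (\<lambda>n. {..real n})"
      by (auto simp: that(2) incseq_def)
    from finite_measure.finite_Lim_measure_incseq[OF that(1) this] show ?thesis
      by (simp add: UN)
  qed
  have "(\<lambda>n. measure (interval_measure G) {..real n})
      \<longlonglongrightarrow> measure (interval_measure F) UNIV + measure (interval_measure ?D) UNIV"
    unfolding Iic by (intro tendsto_add lim) (auto intro: MF.finite_measure_axioms MD.finite_measure_axioms)
  \<comment> \<open>The complement case of the induction below needs additivity of the total
    masses.\<close>
  then have univ: "?P UNIV"
    using lim[OF MG.finite_measure_axioms] by (intro LIMSEQ_unique) auto
  have stable: "Int_stable (range (atMost :: real \<Rightarrow> _))" and closed: "range (atMost :: real \<Rightarrow> _) \<subseteq> Pow UNIV"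
    by (auto simp: Int_stable_def)
  have "?P A" if "A \<in> sigma_sets UNIV (range atMost)" for A
    using stable closed that
  proof (induction rule: sigma_sets_induct_disjoint)
    case (compl A)
    then have "A \<in> sets borel"
      by (simp add: borel_eq_atMost)
    then show ?case
      using compl univ MF.finite_measure_compl[of A] MG.finite_measure_compl[of A] MD.finite_measure_compl[of A]
      by simp
  next
    case (union A)
    then have "range A \<subseteq> sets borel"
      by (simp add: borel_eq_atMost)
    then have "(\<lambda>i. measure (interval_measure F) (A i) + measure (interval_measure ?D) (A i)) sums
        (measure (interval_measure F) (\<Union>i. A i) + measure (interval_measure ?D) (\<Union>i. A i))"
      "(\<lambda>i. measure (interval_measure G) (A i)) sums measure (interval_measure G) (\<Union>i. A i)"
      using union(1) by (auto intro!: sums_add MF.finite_measure_UNION MG.finite_measure_UNION MD.finite_measure_UNION)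
    then show ?case
      using union(3) by (auto intro: sums_unique2)
  qed (auto simp: Iic)
  then have "?P A" if "A \<in> sets borel" for A
    using that by (simp add: borel_eq_atMost)
  \<comment> \<open>The order on measures with equal sigma-algebras compares \<open>emeasure\<close>
    on all sets, including the nonmeasurable ones.\<close>
  moreover have "measure (interval_measure H) A = 0" if "A \<notin> sets borel" for H A
    using that by (simp add: measure_notin_sets)
  ultimately have "measure (interval_measure F) A \<le> measure (interval_measure G) A" for A
    by (cases "A \<in> sets borel") auto
  then show ?thesis
    by (auto simp: le_measure_iff le_fun_def MF.emeasure_eq_measure MG.emeasure_eq_measure)
qed

section \<open>Comparison of densities, and a uniform level\<close>

text \<open>On \<open>{g < f}\<close> the integral of \<open>f\<close> is at most that of
  \<open>g\<close>, so replacing \<open>g\<close> by \<open>max f g\<close> leaves the measure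
  unchanged, and densities over a sigma-finite measure are unique up to null sets.\<close>

lemma AE_le_of_density_le:
  fixes f g :: "'a \<Rightarrow> ennreal"
  assumes "sigma_finite_measure M" and [measurable]: "f \<in> borel_measurable M" "g \<in> borel_measurable M"
    and le: "density M f \<le> density M g"
  shows "AE x in M. f x \<le> g x"
proof -
  interpret sigma_finite_measure M by fact
  have "density M (\<lambda>x. max (f x) (g x)) = density M g"
  proof (rule measure_eqI)
    fix A assume "A \<in> sets (density M (\<lambda>x. max (f x) (g x)))"
    then have A[measurable]: "A \<in> sets M" by simp
    define B where "B = {x \<in> A. g x < f x}"
    have "{x \<in> space M. x \<in> A \<and> g x < f x} \<in> sets M" by measurable
    moreover have "{x \<in> space M. x \<in> A \<and> g x < f x} = B"
      using sets.sets_into_space[OF A] by (auto simp: B_def)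
    ultimately have B[measurable]: "B \<in> sets M" by simp
    have "(\<integral>\<^sup>+x. f x * indicator B x \<partial>M) \<le> (\<integral>\<^sup>+x. g x * indicator B x \<partial>M)"
      using le_measureD3[OF le, of B] by (simp add: emeasure_density)
    \<comment> \<open>The part over \<open>A - B\<close> is added on both sides rather than
      subtracted, since the integrals may be infinite.\<close>
    then have "(\<integral>\<^sup>+x. f x * indicator B x \<partial>M) + (\<integral>\<^sup>+x. g x * indicator (A - B) x \<partial>M)
      \<le> (\<integral>\<^sup>+x. g x * indicator B x \<partial>M) + (\<integral>\<^sup>+x. g x * indicator (A - B) x \<partial>M)"
      by (rule add_right_mono)
    also have "(\<integral>\<^sup>+x. f x * indicator B x \<partial>M) + (\<integral>\<^sup>+x. g x * indicator (A - B) x \<partial>M)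
      = (\<integral>\<^sup>+x. max (f x) (g x) * indicator A x \<partial>M)"
      by (subst nn_integral_add[symmetric])
        (auto intro!: nn_integral_cong simp: B_def indicator_def max_def)
    also have "(\<integral>\<^sup>+x. g x * indicator B x \<partial>M) + (\<integral>\<^sup>+x. g x * indicator (A - B) x \<partial>M)
      = (\<integral>\<^sup>+x. g x * indicator A x \<partial>M)"
      by (subst nn_integral_add[symmetric])
        (auto intro!: nn_integral_cong simp: B_def indicator_def)
    finally have "(\<integral>\<^sup>+x. max (f x) (g x) * indicator A x \<partial>M) = (\<integral>\<^sup>+x. g x * indicator A x \<partial>M)"
      by (rule antisym) (auto intro!: nn_integral_mono mult_right_mono)
    then show "emeasure (density M (\<lambda>x. max (f x) (g x))) A = emeasure (density M g) A"
      by (simp add: emeasure_density)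
  qed simp
  then have "AE x in M. max (f x) (g x) = g x"
    by (intro density_unique) auto
  then show ?thesis
    by eventually_elim (metis max.cobounded1)
qed

text \<open>A uniform level turns a number into an event of that probability; \<open>c\<close> will
  be a value of a conditional survival function. The case \<open>c = 1\<close> is separate because
  the uniform law sits on the open interval.\<close>

lemma emeasure_uniform_measure_ennreal_le:
  assumes "c \<le> 1"
  shows "emeasure (uniform_measure lborel {0<..<1::real}) {u. ennreal u \<le> c} = c"
proof (cases "c = 1")
  case True
  then have "{0<..<1::real} \<inter> {u. ennreal u \<le> c} = {0<..<1}"
    by (auto simp: ennreal_le_1)
  with True show ?thesis
    by (subst emeasure_uniform_measure) auto
next
  case False
  obtain r where r: "c = ennreal r" "0 \<le> r" "r < 1"
    using assms False by (cases c) (auto simp: ennreal_le_1 top_unique)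
  have "{0<..<1::real} \<inter> {u. ennreal u \<le> c} = {0<..r}"
    using r by (auto simp: ennreal_le_iff)
  then show ?thesis
    using r divide_ennreal[of r 1] by (subst emeasure_uniform_measure) auto
qed

section \<open>End points, Borel sets of intervals, and uniqueness\<close>

lemma ex_interval_with_bounds:
  assumes "a \<le> b"
  obtains x :: "real interval" where "lower x = a" "upper x = b"
  using assms that[of "Interval (a, b)"] by (simp add: lower.rep_eq upper.rep_eq Interval_inverse)

lemma set_of_subset_iff: "set_of X \<subseteq> set_of Y \<longleftrightarrow> lower Y \<le> lower X \<and> upper X \<le> upper Y"
  for X Y :: "real interval"
  unfolding set_of_eq atLeastatMost_subset_iff using lower_le_upper[of X] by blast

text \<open>A Hausdorff ball is the preimage of an open square under the end point map;
  \<open>V\<close> is the union of the squares whose balls lie in \<open>U\<close>.\<close>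

lemma openin_ivl_imp_vimage_open:
  assumes "openin ivl.mtopology U"
  obtains V :: "(real \<times> real) set" where "open V" "U = (\<lambda>X. (lower X, upper X)) -` V"
proof
  define B where "B X r = {lower X - r<..<lower X + r} \<times> {upper X - r<..<upper X + r}" for X and r :: real
  define V where "V = \<Union>{B X r | X r. 0 < r \<and> ivl.mball X r \<subseteq> U}"
  show "open V"
    unfolding V_def B_def by (auto intro!: open_Times)
  have ball: "Y \<in> ivl.mball X r \<longleftrightarrow> (lower Y, upper Y) \<in> B X r" for X Y r
    by (auto simp: ivl.mball_def hausdorff_ivl_def B_def)
  show "U = (\<lambda>X. (lower X, upper X)) -` V"
  proof (intro set_eqI iffI)
    fix X assume "X \<in> U"
    then obtain r where "0 < r" "ivl.mball X r \<subseteq> U"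
      using assms unfolding ivl.openin_mtopology by blast
    moreover have "(lower X, upper X) \<in> B X r"
      using \<open>0 < r\<close> by (simp add: B_def)
    ultimately show "X \<in> (\<lambda>X. (lower X, upper X)) -` V"
      unfolding V_def by blast
  next
    fix X assume "X \<in> (\<lambda>X. (lower X, upper X)) -` V"
    then show "X \<in> U"
      unfolding V_def using ball by blast
  qed
qed

text \<open>Containment events make both end point maps measurable, and every open set is the
  preimage of an open planar set under these maps. The empty set joins the generator to make it
  closed under intersection.\<close>

lemma sets_borel_ivl_eq:
  "sets borel_ivl = sigma_sets UNIV (insert {} (range (\<lambda>x. {X. set_of X \<subseteq> set_of x})))"
  (is "_ = sigma_sets UNIV ?E")
proof (rule antisym)
  define S where "S = sigma UNIV ?E"
  have S: "sets S = sigma_sets UNIV ?E" "space S = UNIV"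
    by (simp_all add: S_def)
  have Icc: "{X. a \<le> lower X \<and> upper X \<le> b} \<in> sets S" for a b :: real
  proof (cases "a \<le> b")
    case True
    then obtain x where x: "lower x = a" "upper x = b"
      by (rule ex_interval_with_bounds)
    have "{X. a \<le> lower X \<and> upper X \<le> b} = {X. set_of X \<subseteq> set_of x}"
      by (simp add: set_of_subset_iff x)
    then show ?thesis by (auto simp: S)
  next
    case False
    have "\<not> (a \<le> lower X \<and> upper X \<le> b)" for X
      using False lower_le_upper[of X] by linarith
    then have "{X. a \<le> lower X \<and> upper X \<le> b} = {}"
      by blast
    then show ?thesis by (simp only: sets.empty_sets)
  qed
  \<comment> \<open>Letting the bound on the other end point run to infinity isolates a single end
    point.\<close>
  have "{X. a \<le> lower X} = (\<Union>n::nat. {X. a \<le> lower X \<and> upper X \<le> real n})" for a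
    by (simp add: set_eq_iff real_arch_simple)
  then have l: "lower \<in> borel_measurable S"
    unfolding borel_measurable_iff_ge using Icc by (simp add: S(2))
  have "\<exists>n::nat. - real n \<le> c" for c
    using real_arch_simple[of "- c"] by (auto simp: minus_le_iff)
  then have "{X. upper X \<le> b} = (\<Union>n::nat. {X. - real n \<le> lower X \<and> upper X \<le> b})" for b
    by (simp add: set_eq_iff)
  then have u: "upper \<in> borel_measurable S"
    unfolding borel_measurable_iff_le using Icc by (simp add: S(2))
  have "U \<in> sets S" if U: "openin ivl.mtopology U" for U
  proof -
    obtain V where V: "open V" "U = (\<lambda>X. (lower X, upper X)) -` V"
      by (rule openin_ivl_imp_vimage_open[OF U])
    then show ?thesis
      using measurable_sets[OF borel_measurable_Pair[OF l u] borel_open[OF V(1)]] by (simp add: S(2))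
  qed
  then have "{U. openin ivl.mtopology U} \<subseteq> sets S"
    by blast
  from sets.sigma_sets_subset[OF this] show "sets borel_ivl \<subseteq> sigma_sets UNIV ?E"
    by (simp add: borel_ivl_def S)
  have "?E \<subseteq> sets borel_ivl"
    using sets_borel_ivl_containment by blast
  from sets.sigma_sets_subset[OF this] show "sigma_sets UNIV ?E \<subseteq> sets borel_ivl"
    by (simp add: borel_ivl_def)
qed

lemma measurable_borel_ivl:
  assumes [measurable]: "(\<lambda>x. lower (f x)) \<in> borel_measurable M" "(\<lambda>x. upper (f x)) \<in> borel_measurable M"
  shows "f \<in> measurable M borel_ivl"
  unfolding borel_ivl_def
proof (rule measurable_measure_of)
  fix U assume "U \<in> {U. openin ivl.mtopology U}"
  then obtain V where V: "open V" "U = (\<lambda>X. (lower X, upper X)) -` V"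
    using openin_ivl_imp_vimage_open by blast
  have "(\<lambda>x. (lower (f x), upper (f x))) \<in> borel_measurable M"
    by measurable
  from measurable_sets[OF this borel_open[OF V(1)]] show "f -` U \<inter> space M \<in> sets M"
    by (simp add: V(2) vimage_def)
qed auto

lemma has_containment_df_unique:
  assumes "prob_space M" "sets M = sets borel_ivl" "has_containment_df M F"
    and "prob_space N" "sets N = sets borel_ivl" "has_containment_df N F"
  shows "M = N"
proof (rule measure_eqI_generator_eq)
  interpret M: prob_space M by fact
  interpret N: prob_space N by fact
  let ?C = "\<lambda>x. {X. set_of X \<subseteq> set_of x}"
  let ?E = "insert {} (range ?C) :: real interval set set"
  \<comment> \<open>The intervals from \<open>- n\<close> to \<open>n\<close> give a cover by
    generator sets of finite mass.\<close>
  define J where "J n = Interval (- real n, real n)" for n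
  have J: "lower (J n) = - real n" "upper (J n) = real n" for n
    by (simp_all add: J_def lower.rep_eq upper.rep_eq Interval_inverse)
  show "sets M = sigma_sets UNIV ?E" "sets N = sigma_sets UNIV ?E"
    using assms sets_borel_ivl_eq by simp_all
  show "emeasure M X = emeasure N X" if "X \<in> ?E" for X
    using that assms(3,6) by (auto simp: has_containment_df_def M.emeasure_eq_measure N.emeasure_eq_measure)
  show "Int_stable ?E"
  proof (rule Int_stableI)
    \<comment> \<open>Lying in both \<open>x\<close> and \<open>y\<close> means lying in their
      intersection, which is an interval or empty; in the latter case no \<open>X\<close>
      qualifies.\<close>
    have "?C x \<inter> ?C y \<in> ?E" for x y
    proof (cases "max (lower x) (lower y) \<le> min (upper x) (upper y)")
      case True
      then obtain z where "lower z = max (lower x) (lower y)" "upper z = min (upper x) (upper y)"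
        by (rule ex_interval_with_bounds)
      then have "?C x \<inter> ?C y = ?C z"
        by (auto simp: set_of_subset_iff)
      then show ?thesis by blast
    next
      case False
      have "X \<notin> ?C x \<inter> ?C y" for X
        using False lower_le_upper[of X] unfolding set_of_subset_iff mem_Collect_eq Int_iff by linarith
      then have "?C x \<inter> ?C y = {}"
        by blast
      then show ?thesis by simp
    qed
    then show "A \<inter> B \<in> ?E" if "A \<in> ?E" "B \<in> ?E" for A B
      using that by auto
  qed
  show "(\<Union>n. ?C (J n)) = UNIV"
  proof (intro UNIV_eq_I[symmetric])
    fix X :: "real interval"
    obtain n where "max (- lower X) (upper X) \<le> real n"
      using real_arch_simple by blast
    then have "X \<in> ?C (J n)"
      by (auto simp: set_of_subset_iff J)
    then show "X \<in> (\<Union>n. ?C (J n))" by blast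
  qed
  show "range (\<lambda>n. ?C (J n)) \<subseteq> ?E"
    by blast
  show "emeasure M (?C (J n)) \<noteq> \<infinity>" for n
    by (simp add: M.emeasure_eq_measure)
qed simp

section \<open>Null sets in products and the quantile transform\<close>

lemma AE_pair_fst:
  assumes "sigma_finite_measure M2" "AE x in M1. P x"
  shows "AE p in M1 \<Otimes>\<^sub>M M2. P (fst p)"
proof -
  interpret sigma_finite_measure M2 by fact
  obtain N where N: "{x \<in> space M1. \<not> P x} \<subseteq> N" "N \<in> sets M1" "emeasure M1 N = 0"
    using assms(2) by (auto elim: AE_E)
  then have "emeasure (M1 \<Otimes>\<^sub>M M2) (N \<times> space M2) = 0"
    by (simp add: emeasure_pair_measure_Times)
  then show ?thesis
    using N by (intro AE_I[of _ _ "N \<times> space M2"]) (auto simp: space_pair_measure)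
qed

lemma AE_pair_snd:
  assumes "sigma_finite_measure M2" "AE y in M2. P y"
  shows "AE p in M1 \<Otimes>\<^sub>M M2. P (snd p)"
proof -
  interpret sigma_finite_measure M2 by fact
  obtain N where N: "{x \<in> space M2. \<not> P x} \<subseteq> N" "N \<in> sets M2" "emeasure M2 N = 0"
    using assms(2) by (auto elim: AE_E)
  then have "emeasure (M1 \<Otimes>\<^sub>M M2) (space M1 \<times> N) = 0"
    by (simp add: emeasure_pair_measure_Times)
  then show ?thesis
    using N by (intro AE_I[of _ _ "space M1 \<times> N"]) (auto simp: space_pair_measure)
qed

text \<open>
  Only rational arguments of \<open>h\<close> are inspected: \<open>h\<close> will be a family of Radon-Nikodym derivatives
  at a point, and monotonicity of such a family holds almost everywhere only for countably many
  indices at a time. When the supremum is infinite, \<^const>\<open>real_of_ereal\<close> gives \<open>0\<close>.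
\<close>

definition rat_quantile :: "(real \<Rightarrow> ennreal) \<Rightarrow> real \<Rightarrow> real" where
  "rat_quantile h u = real_of_ereal (SUP q\<in>\<rat>. if ennreal u \<le> h q then ereal q else - \<infinity>)"

text \<open>\<open>SUP_1\<close> puts some \<open>- n\<close> into the set of admissible rationals
  and \<open>zero\<close> bounds that set by \<open>y\<close>, so the supremum is finite and
  \<open>real_of_ereal\<close> loses nothing. The supremum need not be attained, hence the strict
  \<open>q < a\<close> in both directions.\<close>

lemma
  fixes h :: "real \<Rightarrow> ennreal"
  assumes u: "0 < u" "u < 1"
    and antimono: "\<And>p q. p \<in> \<rat> \<Longrightarrow> q \<in> \<rat> \<Longrightarrow> p \<le> q \<Longrightarrow> h q \<le> h p"
    and SUP_1: "(SUP n::nat. h (- real n)) = 1"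
    and zero: "\<And>q. q \<in> \<rat> \<Longrightarrow> y < q \<Longrightarrow> h q = 0"
  shows le_of_le_rat_quantile: "q \<in> \<rat> \<Longrightarrow> q < a \<Longrightarrow> a \<le> rat_quantile h u \<Longrightarrow> ennreal u \<le> h q"
    and le_rat_quantile: "(\<And>q. q \<in> \<rat> \<Longrightarrow> q < a \<Longrightarrow> ennreal u \<le> h q) \<Longrightarrow> a \<le> rat_quantile h u"
proof -
  let ?f = "\<lambda>q. if ennreal u \<le> h q then ereal q else - \<infinity>"
  have "ennreal u < (SUP n::nat. h (- real n))"
    using u unfolding SUP_1 by (simp add: ennreal_less_one_iff)
  then obtain n :: nat where "ennreal u < h (- real n)"
    by (auto simp: less_SUP_iff)
  then have "ereal (- real n) \<le> (SUP q\<in>\<rat>. ?f q)"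
    by (intro SUP_upper2[of "- real n"]) auto
  moreover have "?f q \<le> ereal y" if "q \<in> \<rat>" for q
    using zero[OF that] u by (cases "y < q") auto
  then have "(SUP q\<in>\<rat>. ?f q) \<le> ereal y"
    by (rule SUP_least)
  ultimately have fin: "ereal (rat_quantile h u) = (SUP q\<in>\<rat>. ?f q)"
    unfolding rat_quantile_def by (intro ereal_real') (auto simp: abs_eq_infinity_cases)
  show "ennreal u \<le> h q" if "q \<in> \<rat>" "q < a" "a \<le> rat_quantile h u"
  proof -
    have "ereal q < (SUP q\<in>\<rat>. ?f q)"
      using that fin[symmetric] by simp
    then obtain p where "p \<in> \<rat>" "ereal q < ?f p"
      unfolding less_SUP_iff by blast
    then show ?thesis
      using antimono[of q p] that(1) by (auto split: if_splits)
  qed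
  show "a \<le> rat_quantile h u" if *: "\<And>q. q \<in> \<rat> \<Longrightarrow> q < a \<Longrightarrow> ennreal u \<le> h q"
  proof (rule ccontr)
    assume "\<not> a \<le> rat_quantile h u"
    \<comment> \<open>A rational in this gap would be admissible and exceed the supremum.\<close>
    then obtain q where q: "q \<in> \<rat>" "rat_quantile h u < q" "q < a"
      using Rats_dense_in_real[of "rat_quantile h u" a] by auto
    then have "ereal q \<le> (SUP q\<in>\<rat>. ?f q)"
      using * by (intro SUP_upper2[of q]) auto
    then show False
      using q(2) fin[symmetric] by simp
  qed
qed

section \<open>Construction of the joint law of the end points\<close>

text \<open>Left-continuity of \<open>\<nu>\<close> in its index is not assumed, so the mass of
  \<open>{a..} \<times> B\<close> is enclosed between \<open>\<nu> a\<close> and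
  \<open>\<nu> b\<close> for \<open>b < a\<close>. Hypothesis \<open>zero\<close> expresses that the
  lower end point does not exceed the upper one and keeps the quantile finite.\<close>

lemma ex_planar_measure:
  fixes \<nu> :: "real \<Rightarrow> real measure"
  assumes sets_\<nu>[measurable_cong]: "\<And>x. sets (\<nu> x) = sets borel"
    and antimono: "\<And>x y. x \<le> y \<Longrightarrow> \<nu> y \<le> \<nu> x"
    and total: "(SUP n::nat. emeasure (\<nu> (- real n)) UNIV) = 1"
    and zero: "\<And>x. emeasure (\<nu> x) {..<x} = 0"
  obtains N :: "(real \<times> real) measure" where "prob_space N" "sets N = sets borel"
    and "\<And>a B. B \<in> sets borel \<Longrightarrow> emeasure (\<nu> a) B \<le> emeasure N ({a..} \<times> B)"
    and "\<And>a b B. B \<in> sets borel \<Longrightarrow> b < a \<Longrightarrow> emeasure N ({a..} \<times> B) \<le> emeasure (\<nu> b) B"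
proof -
  define \<mu> where "\<mu> = (SUP n::nat. \<nu> (- real n))"
  have sets_\<mu>[measurable_cong]: "sets \<mu> = sets borel"
    unfolding \<mu>_def by (rule sets_SUP) (auto simp: sets_\<nu>)
  then have space_\<mu>[simp]: "space \<mu> = UNIV"
    using sets_eq_imp_space_eq by fastforce
  \<comment> \<open>Along a chain the supremum of measures is taken setwise.\<close>
  have chain: "Complete_Partial_Order.chain (\<le>) (range (\<lambda>n::nat. \<nu> (- real n)))"
    using antimono by (auto simp: Complete_Partial_Order.chain_def) (meson linorder_linear neg_le_iff_le of_nat_le_iff)
  have em_\<mu>: "emeasure \<mu> A = (SUP n::nat. emeasure (\<nu> (- real n)) A)" if "A \<in> sets borel" for A
    unfolding \<mu>_def using that chain by (intro emeasure_SUP_chain[where N = borel]) (auto simp: sets_\<nu>)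
  interpret \<mu>: prob_space \<mu>
    using em_\<mu>[of UNIV] total by (intro prob_spaceI) simp
  have le_\<mu>: "\<nu> x \<le> \<mu>" for x
  proof -
    obtain n :: nat where "- real n \<le> x"
      using real_arch_simple[of "- x"] by (auto simp: minus_le_iff)
    then have "\<nu> x \<le> \<nu> (- real n)"
      by (rule antimono)
    also have "\<dots> \<le> \<mu>"
      unfolding \<mu>_def by (rule SUP_upper) simp
    finally show ?thesis .
  qed
  define g where "g x = RN_deriv \<mu> (\<nu> x)" for x
  have g[measurable]: "g x \<in> borel_measurable borel" for x
    using borel_measurable_RN_deriv[of \<mu> "\<nu> x"] measurable_cong_sets[OF sets_\<mu> refl] by (simp add: g_def)
  \<comment> \<open>Domination by \<open>\<mu>\<close> gives absolute continuity, so the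
    Radon-Nikodym derivative is a density.\<close>
  have density: "density \<mu> (g x) = \<nu> x" for x
    unfolding g_def
  proof (rule \<mu>.density_RN_deriv)
    show "absolutely_continuous \<mu> (\<nu> x)"
      using le_measureD3[OF le_\<mu>[of x]]
      by (auto simp: absolutely_continuous_def null_sets_def sets_\<mu> sets_\<nu> le_zero_eq[symmetric] simp del: le_zero_eq)
        (metis order_trans)
  qed (simp add: sets_\<mu> sets_\<nu>)
  have em_g: "emeasure (\<nu> x) A = (\<integral>\<^sup>+y. g x y * indicator A y \<partial>\<mu>)" if "A \<in> sets borel" for x A
    using that unfolding density[symmetric] by (intro emeasure_density) (auto simp: sets_\<mu>)
  have g_mono: "AE y in \<mu>. g q y \<le> g p y" if "p \<le> q" for p q
    using antimono[OF that] by (intro AE_le_of_density_le) (auto simp: density \<mu>.sigma_finite_measure_axioms)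
  \<comment> \<open>The constant 1 is the density of \<open>\<mu>\<close> with respect to
    itself.\<close>
  have g_le_1: "AE y in \<mu>. g x y \<le> 1" for x
    using le_\<mu>[of x] by (intro AE_le_of_density_le) (auto simp: density density_1 \<mu>.sigma_finite_measure_axioms)
  have g_zero: "AE y in \<mu>. y < q \<longrightarrow> g q y = 0" for q
  proof -
    have "(\<integral>\<^sup>+y. g q y * indicator {..<q} y \<partial>\<mu>) = 0"
      using zero[of q] by (simp add: em_g)
    then have "AE y in \<mu>. g q y * indicator {..<q} y = 0"
      by (subst (asm) nn_integral_0_iff_AE) auto
    then show ?thesis
      by eventually_elim (auto simp: indicator_def)
  qed
  \<comment> \<open>By monotone convergence the supremum of the \<open>g (- n)\<close> is a density
    of \<open>\<mu>\<close> with respect to itself, hence almost everywhere 1.\<close>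
  have g_SUP: "AE y in \<mu>. (SUP n::nat. g (- real n) y) = 1"
  proof -
    have step: "AE y in \<mu>. \<forall>n. g (- real n) y \<le> g (- real (Suc n)) y"
      unfolding AE_all_countable by (intro allI g_mono) simp
    have "density \<mu> (\<lambda>y. SUP n::nat. g (- real n) y) = density \<mu> (\<lambda>_. 1)"
    proof (rule measure_eqI)
      fix A assume "A \<in> sets (density \<mu> (\<lambda>y. SUP n::nat. g (- real n) y))"
      then have A[measurable]: "A \<in> sets borel"
        by (simp add: sets_\<mu>)
      have "(\<integral>\<^sup>+y. (SUP n::nat. g (- real n) y) * indicator A y \<partial>\<mu>)
          = (\<integral>\<^sup>+y. (SUP n::nat. g (- real n) y * indicator A y) \<partial>\<mu>)"
        by (simp add: SUP_mult_right_ennreal)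
      also have "\<dots> = (SUP n::nat. \<integral>\<^sup>+y. g (- real n) y * indicator A y \<partial>\<mu>)"
        by (rule nn_integral_monotone_convergence_SUP_AE)
          (use step in \<open>auto elim!: eventually_mono intro!: mult_right_mono\<close>)
      also have "\<dots> = emeasure \<mu> A"
        by (simp add: em_\<mu> em_g)
      finally show "emeasure (density \<mu> (\<lambda>y. SUP n::nat. g (- real n) y)) A = emeasure (density \<mu> (\<lambda>_. 1)) A"
        by (simp add: emeasure_density sets_\<mu>)
    qed simp
    then show ?thesis
      by (intro \<mu>.density_unique) auto
  qed
  define U where "U = uniform_measure lborel {0<..<1::real}"
  have sets_U[measurable_cong]: "sets U = sets borel"
    by (simp add: U_def)
  interpret U: prob_space U
    unfolding U_def by (rule prob_space_uniform_measure) auto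
  interpret P: pair_prob_space \<mu> U ..
  define T where "T p = (rat_quantile (\<lambda>q. g q (fst p)) (snd p), fst p)" for p
  \<comment> \<open>The supremum in \<open>rat_quantile\<close> runs over a countable set.\<close>
  have T[measurable]: "T \<in> measurable (\<mu> \<Otimes>\<^sub>M U) borel"
    unfolding T_def rat_quantile_def using countable_rat by measurable
  define N where "N = distr (\<mu> \<Otimes>\<^sub>M U) borel T"
  have "AE u in U. 0 < u \<and> u < 1"
    unfolding U_def by (rule AE_uniform_measureI) auto
  then have AE_u: "AE p in \<mu> \<Otimes>\<^sub>M U. 0 < snd p \<and> snd p < 1"
    by (rule AE_pair_snd[OF U.sigma_finite_measure_axioms])
  have "AE y in \<mu>. \<forall>p\<in>\<rat>. \<forall>q\<in>\<rat>. p \<le> q \<longrightarrow> g q y \<le> g p y"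
    by (intro AE_ball_countable[THEN iffD2] ballI countable_rat) (auto intro: g_mono)
  note AE_mono = AE_pair_fst[OF U.sigma_finite_measure_axioms this]
  have "AE y in \<mu>. \<forall>q\<in>\<rat>. y < q \<longrightarrow> g q y = 0"
    by (intro AE_ball_countable[THEN iffD2] ballI countable_rat g_zero)
  note AE_zero = AE_pair_fst[OF U.sigma_finite_measure_axioms this]
  note AE_SUP = AE_pair_fst[OF U.sigma_finite_measure_axioms g_SUP]
  \<comment> \<open>By Fubini \<open>C B q\<close> has probability \<open>\<nu> q B\<close>: its
    slice at \<open>y \<in> B\<close> is a uniform level below \<open>g q y\<close>. Both bounds on
    \<open>N\<close> come from comparison with such events.\<close>
  define C where "C B q = {p \<in> space (\<mu> \<Otimes>\<^sub>M U). ennreal (snd p) \<le> g q (fst p) \<and> fst p \<in> B}" for B q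
  have C[measurable]: "C B q \<in> sets (\<mu> \<Otimes>\<^sub>M U)" if [measurable]: "B \<in> sets borel" for B q
    unfolding C_def by measurable
  have em_C: "emeasure (\<mu> \<Otimes>\<^sub>M U) (C B q) = emeasure (\<nu> q) B" if B: "B \<in> sets borel" for B q
  proof -
    have "emeasure (\<mu> \<Otimes>\<^sub>M U) (C B q) = (\<integral>\<^sup>+y. emeasure U (Pair y -` C B q) \<partial>\<mu>)"
      by (rule U.emeasure_pair_measure_alt[OF C[OF B]])
    also have "\<dots> = (\<integral>\<^sup>+y. g q y * indicator B y \<partial>\<mu>)"
    proof (rule nn_integral_cong_AE, use g_le_1[of q] in eventually_elim)
      fix y assume "g q y \<le> 1"
      moreover have "Pair y -` C B q = (if y \<in> B then {u. ennreal u \<le> g q y} else {})"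
        by (auto simp: C_def space_pair_measure U_def)
      ultimately show "emeasure U (Pair y -` C B q) = g q y * indicator B y"
        using emeasure_uniform_measure_ennreal_le[of "g q y"] by (simp add: U_def del: emeasure_uniform_measure)
    qed
    also have "\<dots> = emeasure (\<nu> q) B"
      using B by (simp add: em_g)
    finally show ?thesis .
  qed
  have em_N: "emeasure N ({a..} \<times> B) = emeasure (\<mu> \<Otimes>\<^sub>M U) (T -` ({a..} \<times> B) \<inter> space (\<mu> \<Otimes>\<^sub>M U))"
    if "B \<in> sets borel" for a B
    unfolding N_def using that by (intro emeasure_distr T) (auto simp: borel_prod[symmetric])
  show ?thesis
  proof
    show "prob_space N"
      unfolding N_def by (rule P.prob_space_distr) (rule T)
    show "sets N = sets borel"
      by (simp add: N_def)
    fix a :: real and B :: "real set" assume B: "B \<in> sets borel"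
    have vimage: "T -` ({a..} \<times> B) \<inter> space (\<mu> \<Otimes>\<^sub>M U) \<in> sets (\<mu> \<Otimes>\<^sub>M U)"
      using B by (intro measurable_sets[OF T]) (auto simp: borel_prod[symmetric])
    \<comment> \<open>\<open>a\<close> may be irrational, so it needs its own null set. Outside it,
      \<open>u \<le> g a y\<close> passes to all rational \<open>q < a\<close>, as
      \<open>le_rat_quantile\<close> asks.\<close>
    have "AE y in \<mu>. \<forall>q\<in>\<rat>. q < a \<longrightarrow> g a y \<le> g q y"
      by (intro AE_ball_countable[THEN iffD2] ballI countable_rat) (auto intro: g_mono)
    note AE_a = AE_pair_fst[OF U.sigma_finite_measure_axioms this]
    have "AE p in \<mu> \<Otimes>\<^sub>M U. p \<in> C B a \<longrightarrow> p \<in> T -` ({a..} \<times> B) \<inter> space (\<mu> \<Otimes>\<^sub>M U)"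
      using AE_u AE_mono AE_zero AE_SUP AE_a
    proof eventually_elim
      case (elim p)
      have "a \<le> rat_quantile (\<lambda>q. g q (fst p)) (snd p)" if "ennreal (snd p) \<le> g a (fst p)"
        using elim that by (intro le_rat_quantile[where y = "fst p"]) (auto intro: order_trans)
      then show ?case
        by (auto simp: C_def T_def)
    qed
    then show "emeasure (\<nu> a) B \<le> emeasure N ({a..} \<times> B)"
      unfolding em_N[OF B] em_C[OF B, symmetric] using vimage by (rule emeasure_mono_AE)
    fix b assume "b < a"
    \<comment> \<open>The quantile controls \<open>g\<close> at rational indices below
      \<open>a\<close>; the gap above \<open>b\<close> leaves room for one.\<close>
    then obtain q where q: "q \<in> \<rat>" "b < q" "q < a"
      using Rats_dense_in_real by blast
    have "AE p in \<mu> \<Otimes>\<^sub>M U. p \<in> T -` ({a..} \<times> B) \<inter> space (\<mu> \<Otimes>\<^sub>M U) \<longrightarrow> p \<in> C B q"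
      using AE_u AE_mono AE_zero AE_SUP
    proof eventually_elim
      case (elim p)
      have "ennreal (snd p) \<le> g q (fst p)" if "a \<le> rat_quantile (\<lambda>q. g q (fst p)) (snd p)"
        using elim q that by (intro le_of_le_rat_quantile[where y = "fst p" and h = "\<lambda>q. g q (fst p)" and a = a]) auto
      then show ?case
        by (auto simp: C_def T_def)
    qed
    then have "emeasure N ({a..} \<times> B) \<le> emeasure (\<nu> q) B"
      unfolding em_N[OF B] em_C[OF B, symmetric] using C[OF B] by (rule emeasure_mono_AE)
    also have "\<dots> \<le> emeasure (\<nu> b) B"
      using antimono[of b q] q(2) by (intro le_measureD3) (auto simp: sets_\<nu>)
    finally show "emeasure N ({a..} \<times> B) \<le> emeasure (\<nu> b) B" .
  qed
qed

section \<open>Existence and uniqueness of the distribution\<close>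

theorem theorem3:
  fixes F :: "real \<Rightarrow> real \<Rightarrow> real"
  assumes "containment_df F"
    and "\<And>yl xl xu yu. yl \<le> xu \<Longrightarrow> xu < xl \<Longrightarrow> xl \<le> yu \<Longrightarrow>
           F yl yu - F yl xu - F xl yu + F xl xu \<ge> 0"
  shows "\<exists>!M :: real interval measure.
           prob_space M \<and> sets M = sets borel_ivl \<and> has_containment_df M F"
proof (rule ex_ex1I)
  have range: "0 \<le> F x y" "F x y \<le> 1" for x y
    using assms(1) by (auto simp: containment_df_def)
  have lim: "((\<lambda>(x, y). F x y) \<longlongrightarrow> 1) (at_bot \<times>\<^sub>F at_top)"
    using assms(1) by (auto simp: containment_df_def)
  have zero: "F x y = 0" if "y < x" for x y
    using assms(1) that by (auto simp: containment_df_def)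
  have left: "continuous (at_left x) (\<lambda>x'. F x' y)" and right: "continuous (at_right y) (F x)" for x y
    using assms(1) by (auto simp: containment_df_def)
  have anti: "F x' y \<le> F x y" if "x \<le> x'" for x x' y
    using assms(1) that by (auto simp: containment_df_def monotone_def)
  have mono: "mono (F x)" for x
    using assms(1) by (auto simp: containment_df_def)
  \<comment> \<open>This says that \<open>F x - F x'\<close> is monotone, as
    \<open>interval_measure_le\<close> requires. Only overlapping or disjoint inner end points use a
    rectangle inequality; in the other cases two terms vanish and monotonicity in one argument
    remains.\<close>
  have rect: "F x' y' - F x' y \<le> F x y' - F x y" if "x \<le> x'" "y \<le> y'" for x x' y y'
  proof -
    consider "x' \<le> y" | "y < x" | "y' < x'" | "x \<le> y" "y < x'" "x' \<le> y'"
      using that by linarith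
    then show ?thesis
    proof cases
      case 1
      then have "F x y' - F x y - F x' y' + F x' y \<ge> 0"
        using assms(1) that by (auto simp: containment_df_def)
      then show ?thesis by simp
    next
      case 2
      then show ?thesis
        using zero[of y x] zero[of y x'] anti[of x x' y'] that by simp
    next
      case 3
      then show ?thesis
        using zero[of y' x'] zero[of y x'] monoD[OF mono, of y y' x] that by simp
    next
      case 4
      then show ?thesis
        using assms(2)[of x y x' y'] by simp
    qed
  qed
  have at_bot: "(F x \<longlongrightarrow> 0) at_bot" for x
    by (intro tendsto_eventually eventually_mono[OF eventually_gt_at_bot[of x]] zero)
  have bdd: "bdd_above (range (F x))" for x
    using range(2)[of x] by (auto simp: bdd_above_def)
  define \<nu> where "\<nu> x = interval_measure (F x)" for x
  have Iic: "emeasure (\<nu> x) {..y} = F x y" for x y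
    unfolding \<nu>_def using mono right at_bot by (intro emeasure_interval_measure_Iic) (auto simp: mono_def)
  have sets_\<nu>: "sets (\<nu> x) = sets borel" for x
    by (simp add: \<nu>_def)
  \<comment> \<open>The open half-line is covered by countably many \<open>{..q}\<close> with
    rational \<open>q < x\<close>, each null because \<open>F x q = 0\<close>.\<close>
  have Iio: "emeasure (\<nu> x) {..<x} = 0" for x
  proof -
    have "(\<Union>q\<in>\<rat> \<inter> {..<x}. {..q}) \<in> null_sets (\<nu> x)"
      by (rule null_sets_UN') (auto simp: countable_rat countable_Int1 null_sets_def sets_\<nu> Iic zero)
    moreover have "{..<x} \<subseteq> (\<Union>q\<in>\<rat> \<inter> {..<x}. {..q})"
      using Rats_dense_in_real less_imp_le by fastforce
    ultimately show ?thesis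
      by (intro emeasure_eq_0[OF null_setsD2 null_setsD1])
  qed
  have UNIV_le: "emeasure (\<nu> x) UNIV \<le> 1" for x
  proof -
    have "emeasure (\<nu> x) (\<Union>n. {..real n}) = (SUP n. emeasure (\<nu> x) {..real n})"
      by (rule SUP_emeasure_incseq[symmetric]) (auto simp: sets_\<nu> incseq_def)
    also have "(\<Union>n. {..real n}) = UNIV"
      using real_arch_simple by auto
    finally show ?thesis
      by (simp add: Iic SUP_le_iff range)
  qed
  \<comment> \<open>The joint limit is used along the diagonal, where \<open>F (- n) n\<close> is at
    most the mass of \<open>\<nu> (- n)\<close>.\<close>
  have "(\<lambda>n. F (- real n) (real n)) \<longlonglongrightarrow> 1"
    using filterlim_compose[OF lim filterlim_Pair[OF
        filterlim_uminus_at_bot_at_top[THEN filterlim_compose, OF filterlim_real_sequentially]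
        filterlim_real_sequentially]]
    by simp
  then have "(\<lambda>n. ennreal (F (- real n) (real n))) \<longlonglongrightarrow> 1"
    using tendsto_ennrealI by fastforce
  moreover have "ennreal (F (- real n) (real n)) \<le> (SUP n::nat. emeasure (\<nu> (- real n)) UNIV)" for n
    unfolding Iic[symmetric] by (rule SUP_upper2[of n]) (auto intro!: emeasure_mono simp: sets_\<nu>)
  ultimately have "1 \<le> (SUP n::nat. emeasure (\<nu> (- real n)) UNIV)"
    by (intro LIMSEQ_le_const2) auto
  then have total: "(SUP n::nat. emeasure (\<nu> (- real n)) UNIV) = 1"
    by (intro antisym SUP_least UNIV_le)
  have "\<nu> y \<le> \<nu> x" if "x \<le> y" for x y
    unfolding \<nu>_def using rect[OF that] mono right at_bot bdd
    by (intro interval_measure_le) (auto simp: mono_def algebra_simps)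
  then obtain N where N: "prob_space N" "sets N = sets (borel :: (real \<times> real) measure)"
    and lower: "\<And>a B. B \<in> sets borel \<Longrightarrow> emeasure (\<nu> a) B \<le> emeasure N ({a..} \<times> B)"
    and upper: "\<And>a b B. B \<in> sets borel \<Longrightarrow> b < a \<Longrightarrow> emeasure N ({a..} \<times> B) \<le> emeasure (\<nu> b) B"
    using ex_planar_measure[of \<nu>, OF sets_\<nu> _ total Iio] by metis
  interpret N: prob_space N by fact
  have quadrant: "measure N ({a..} \<times> {..b}) = F a b" for a b
  proof (rule antisym)
    show "F a b \<le> measure N ({a..} \<times> {..b})"
      using lower[of "{..b}" a] by (simp add: Iic N.emeasure_eq_measure)
    have "\<forall>\<^sub>F x in at_left a. measure N ({a..} \<times> {..b}) \<le> F x b"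
      using upper[of "{..b}" _ a] range by (auto simp: Iic N.emeasure_eq_measure eventually_at_filter)
    moreover have "((\<lambda>x. F x b) \<longlongrightarrow> F a b) (at_left a)"
      using left by (simp add: continuous_within)
    ultimately show "measure N ({a..} \<times> {..b}) \<le> F a b"
      by (intro tendsto_lowerbound) auto
  qed
  have meas: "{a..} \<times> {..b} \<in> sets N" for a b :: real
    unfolding N(2) borel_prod[symmetric] by auto
  \<comment> \<open>Countably many null quadrants with rational corners cover the region
    \<open>snd p < fst p\<close>.\<close>
  have "AE p in N. \<not> (q \<le> fst p \<and> snd p \<le> r)" if "r < q" for q r
  proof (rule AE_I[of _ _ "{q..} \<times> {..r}"])
    show "emeasure N ({q..} \<times> {..r}) = 0"
      using quadrant[of q r] zero[OF that] by (simp add: N.emeasure_eq_measure)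
  qed (auto simp: meas)
  then have "AE p in N. \<forall>q\<in>\<rat>. \<forall>r\<in>\<rat>. r < q \<longrightarrow> \<not> (q \<le> fst p \<and> snd p \<le> r)"
    by (intro AE_ball_countable[THEN iffD2] ballI countable_rat) auto
  then have AE_le: "AE p in N. fst p \<le> snd p"
  proof eventually_elim
    case (elim p)
    show ?case
    proof (rule ccontr)
      assume "\<not> fst p \<le> snd p"
      then obtain q where q: "q \<in> \<rat>" "snd p < q" "q < fst p"
        using Rats_dense_in_real[of "snd p" "fst p"] by auto
      \<comment> \<open>A second rational is needed because the quadrant is null only for
        \<open>r < q\<close>.\<close>
      then obtain r where "r \<in> \<rat>" "snd p < r" "r < q"
        using Rats_dense_in_real by blast
      then show False
        using elim q by fastforce
    qed
  qed
  \<comment> \<open>The minimum keeps the pair ordered on the exceptional null set too, where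
    \<open>Interval\<close> would be unspecified; almost everywhere it equals
    \<open>fst p\<close>.\<close>
  define f where "f p = Interval (min (fst p) (snd p), snd p)" for p :: "real \<times> real"
  have f: "lower (f p) = min (fst p) (snd p)" "upper (f p) = snd p" for p
    by (simp_all add: f_def lower.rep_eq upper.rep_eq Interval_inverse)
  have f_meas: "f \<in> measurable N borel_ivl"
    unfolding measurable_cong_sets[OF N(2) refl]
    by (intro measurable_borel_ivl) (auto simp: f borel_prod[symmetric])
  have "measure (distr N borel_ivl f) {X. set_of X \<subseteq> set_of x} = F (lower x) (upper x)" for x
  proof -
    have "measure (distr N borel_ivl f) {X. set_of X \<subseteq> set_of x} = measure N (f -` {X. set_of X \<subseteq> set_of x} \<inter> space N)"
      using f_meas sets_borel_ivl_containment by (rule measure_distr)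
    also have "\<dots> = measure N ({lower x..} \<times> {..upper x})"
    proof (rule N.finite_measure_eq_AE)
      show "AE p in N. (p \<in> f -` {X. set_of X \<subseteq> set_of x} \<inter> space N) = (p \<in> {lower x..} \<times> {..upper x})"
        using AE_le AE_space
        by eventually_elim (auto simp: set_of_subset_iff f mem_Times_iff)
      show "f -` {X. set_of X \<subseteq> set_of x} \<inter> space N \<in> sets N"
        using f_meas sets_borel_ivl_containment by (rule measurable_sets)
    qed (rule meas)
    finally show ?thesis
      by (simp add: quadrant)
  qed
  then show "\<exists>M. prob_space M \<and> sets M = sets borel_ivl \<and> has_containment_df M F"
    using N.prob_space_distr[OF f_meas]
    by (intro exI[of _ "distr N borel_ivl f"]) (auto simp: has_containment_df_def)
qed (auto intro: has_containment_df_unique)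

end
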